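(* Let $\alpha,\beta>0$. Let $\mathcal F:\mathcal P_\Theta\to\mathbb{R}$ be a functional depending only on the kernel mean embedding of $q_\theta$; precisely, assume $\mathcal F(q_\theta)=H(\mu_{q_\theta})$ for some functional $H$ with the chain rule property $$\partial_{\theta_i}[H(\mu_{q_\theta})]=\langle h_\theta,\partial_{\theta_i}[\mu_{q_\theta}]\rangle_{\mathcal H}\qquad(i=1,\dots,n)$$ for some function $h_\theta\in\mathcal H$, for all $\theta\in\Theta$. Then the gradient of $\mathcal F$ with respect to $d_{\alpha,\beta}$ is $$\mathrm{grad}_{d_{\alpha,\beta}}\mathcal F(q_\theta)=L_\theta u,\qquad\text{where } u\in\mathcal H\text{ solves }\ (\alpha D_\theta+\beta I)u=h_\theta .$$
   Context: Setting. $\Omega\subset\mathbb{R}^d$ is open and $\mathcal{H}$ is a reproducing kernel Hilbert space of real functions on $\Omega$ with bounded kernel $k$; $\langle\cdot,\cdot\rangle_{\mathcal H},\|\cdot\|_{\mathcal H}$ are its inner product and norm, and $\langle\cdot,\cdot\rangle,\|\cdot\|$ the Euclidean ones. The map $x\mapsto k(x,\cdot)\in\mathcal H$ is differentiable, $\nabla_x k(x,\cdot)\in\mathcal{H}^d$ is its gradient (in the first argument), so $\nabla f(x)=\langle f,\nabla_x k(x,\cdot)\rangle_{\mathcal H}$ for $f\in\mathcal H$. $\mathcal{Z}\subset\mathbb{R}^m$ is open with a probability distribution $\nu$; $\Theta\subset\mathbb{R}^n$ is a parameter space (all parameter points under consideration are understood to lie in $\Theta$); $G_\theta=(G_\theta^1,\dots,G_\theta^d):\mathcal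 Z\to\Omega$ is differentiable in $\theta$. It is assumed that $\|k(x,\cdot)-k(y,\cdot)\|_{\mathcal H}\le L\|x-y\|$ and $\|G_\theta(z)-G_{\theta'}(z)\|\le D(z)\|\theta-\theta'\|$ for a constant $L>0$ and a function $D:\mathcal Z\to[0,\infty)$ with $\mathbb{E}_\nu[D(z)^2]<\infty$. Put $q_\theta=(G_\theta)_\#\nu$ (push-forward) and $\mathcal P_\Theta=\{q_\theta:\theta\in\Theta\}$. For a probability distribution $\rho$ on $\Omega$, $\mu_\rho(x)=\int k(x,y)\rho(dy)\in\mathcal H$ is the kernel mean embedding. Operators. $J_\theta G_\theta(z)=\big(\partial G_\theta^j(z)/\partial\theta_i\big)_{ij}\in\mathbb{R}^{n\times d}$. $L_\theta:\mathcal H\to\mathbb{R}^n$, $L_\theta(f)=\int J_\theta G_\theta(z)\nabla f(G_\theta(z))\,\nu(dz)$; $L_\theta^\top:\mathbb{R}^n\to\mathcal H$, $L_\theta^\top(v)=\int\langle\nabla_x k(G_\theta(z),\cdot),J_\theta G_\theta(z)^\top v\rangle\,\nu(dz)$; $D_\theta=L_\theta^\top L_\theta:\mathcal H\to\mathcal H$ (symmetric, positive semidefinite); $I$ is the identity on $\mathcal H$, and $\alpha D_\theta+\beta I$ is invertible. Metric and gradient. $d_{\alpha,\beta}(q_{\theta_0},q_{\theta_1})^2=\min_{(\theta_t,f_t)}\int_0^1\big(\alpha\|D_{\theta_t}f_t\|_{\mathcal H}^2+\beta\langle f_t,D_{\theta_t}f_t\rangle_{\mathcal H}\big)dt$ over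 paths with $\partial_t\theta_t=L_{\theta_t}f_t$, $f_t\in\mathcal H$, $\theta_{t=0}=\theta_0,\theta_{t=1}=\theta_1$. The associated metric tensor is, for $\xi_i=L_\theta\varphi_i$ with $\varphi_i\in\mathcal H$ ($i=1,2$), $$g_\theta(\xi_1,\xi_2)=\alpha\langle D_\theta\varphi_1,D_\theta\varphi_2\rangle_{\mathcal H}+\beta\langle\varphi_1,D_\theta\varphi_2\rangle_{\mathcal H}.$$ For $\mathcal F:\mathcal P_\Theta\to\mathbb{R}$, the gradient $\mathrm{grad}_{d_{\alpha,\beta}}\mathcal F(q_\theta)$ is the vector in $\mathbb{R}^n$ (in the range of $L_\theta$, where $g_\theta$ is defined) satisfying $\frac{d}{dt}\mathcal F(q_{\theta_t})\big|_{t=0}=g_\theta(\mathrm{grad}_{d_{\alpha,\beta}}\mathcal F(q_\theta),\xi)$ for every differentiable curve $t\mapsto\theta_t\in\Theta$ with $\theta_{t=0}=\theta$ and $\partial_t\theta_t|_{t=0}=\xi=L_\theta\varphi$ for some $\varphi\in\mathcal H$. The chain rule property is understood with $\theta\mapsto H(\mu_{q_\theta})$ differentiable. *)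

theory Defs
  imports "HOL-Analysis.Analysis" "HOL-Probability.Probability_Measure"
begin

text \<open>
  A Hilbert space of real functions on \<open>\<Omega>\<close> is modelled by a type \<open>'h\<close> of class
  \<open>{real_inner, banach}\<close> together with the evaluation map \<open>ev :: 'h \<Rightarrow> real ^ 'd \<Rightarrow> real\<close>, where
  elements of \<open>'h\<close> are determined by their values on \<open>\<Omega>\<close>. The element \<open>K x\<close> is the function
  \<open>k(x, \<cdot>)\<close>, so the kernel is \<open>k(x, y) = ev (K x) y\<close>.

  The Bochner integral of the library needs \<open>'h\<close> to be second countable. This costs no
  generality below: \<open>K\<close> is Lipschitz on the separable set \<open>\<Omega>\<close> and the \<open>K x\<close> span a dense
  subspace, so \<open>'h\<close> is separable.
\<close>

locale rkhs =
  fixes \<Omega> :: "(real ^ 'd) set"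
    and ev :: "'h::{real_inner, banach} \<Rightarrow> real ^ 'd \<Rightarrow> real"
    and K :: "real ^ 'd \<Rightarrow> 'h"
  assumes ev_linear: "\<And>x. x \<in> \<Omega> \<Longrightarrow> linear (\<lambda>f. ev f x)"
    and ev_inject: "\<And>f g. (\<And>x. x \<in> \<Omega> \<Longrightarrow> ev f x = ev g x) \<Longrightarrow> f = g"
    and reproducing: "\<And>f x. x \<in> \<Omega> \<Longrightarrow> ev f x = inner f (K x)"

text \<open>
  The partial derivative in direction \<open>i\<close> of a function on \<open>S\<close>; for points in the interior
  of \<open>S\<close> it is the usual one.
\<close>

definition partial_deriv ::
    "(real ^ 'k) set \<Rightarrow> 'k \<Rightarrow> (real ^ 'k \<Rightarrow> 'b::real_normed_vector) \<Rightarrow> real ^ 'k \<Rightarrow> 'b" where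
  "partial_deriv S i f x =
     vector_derivative (\<lambda>t. f (x + t *\<^sub>R axis i 1)) (at 0 within {t. x + t *\<^sub>R axis i 1 \<in> S})"

text \<open>
  The condition \<open>Theta_directions\<close> says that difference quotients in every coordinate direction
  can be formed at every parameter, i.e. that \<open>\<partial>\<^bsub>\<theta>\<^sub>i\<^esub>\<close> is meaningful on \<open>\<Theta>\<close>. It holds for every
  open \<open>\<Theta>\<close>, and also for boxes that are not open.
\<close>

locale pushforward_model = rkhs \<Omega> ev K + prob_space \<nu>
  for \<Omega> :: "(real ^ 'd) set"
    and ev :: "'h::{real_inner, banach, second_countable_topology} \<Rightarrow> real ^ 'd \<Rightarrow> real"
    and K :: "real ^ 'd \<Rightarrow> 'h"
    and \<nu> :: "(real ^ 'm) measure" +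
  fixes Z :: "(real ^ 'm) set"
    and \<Theta> :: "(real ^ 'n) set"
    and G :: "real ^ 'n \<Rightarrow> real ^ 'm \<Rightarrow> real ^ 'd"
    and L :: real
    and D :: "real ^ 'm \<Rightarrow> real"
  assumes open_Omega: "open \<Omega>"
    and bounded_kernel: "\<exists>B. \<forall>x\<in>\<Omega>. \<forall>y\<in>\<Omega>. \<bar>ev (K x) y\<bar> \<le> B"
    and K_differentiable: "\<And>x. x \<in> \<Omega> \<Longrightarrow> K differentiable (at x)"
    and L_pos: "L > 0"
    and K_lipschitz: "\<And>x y. x \<in> \<Omega> \<Longrightarrow> y \<in> \<Omega> \<Longrightarrow> norm (K x - K y) \<le> L * norm (x - y)"
    and open_Z: "open Z"
    and sets_nu: "sets \<nu> = sets (restrict_space borel Z)"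
    and Theta_directions:
      "\<And>\<theta> i. \<theta> \<in> \<Theta> \<Longrightarrow> 0 islimpt {t. \<theta> + t *\<^sub>R axis i 1 \<in> \<Theta>}"
    and G_measurable: "\<And>\<theta>. \<theta> \<in> \<Theta> \<Longrightarrow> G \<theta> \<in> measurable \<nu> (restrict_space borel \<Omega>)"
    and G_differentiable:
      "\<And>\<theta> z. \<theta> \<in> \<Theta> \<Longrightarrow> z \<in> Z \<Longrightarrow> (\<lambda>\<eta>. G \<eta> z) differentiable (at \<theta> within \<Theta>)"
    and D_nonneg: "\<And>z. z \<in> Z \<Longrightarrow> D z \<ge> 0"
    and D_square_integrable: "D \<in> borel_measurable \<nu>" "integrable \<nu> (\<lambda>z. (D z)\<^sup>2)"
    and G_lipschitz:
      "\<And>\<theta> \<theta>' z. \<theta> \<in> \<Theta> \<Longrightarrow> \<theta>' \<in> \<Theta> \<Longrightarrow> z \<in> Z \<Longrightarrow>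
         norm (G \<theta> z - G \<theta>' z) \<le> D z * norm (\<theta> - \<theta>')"

definition pushforward ::
    "(real ^ 'd) set \<Rightarrow> (real ^ 'm) measure \<Rightarrow> (real ^ 'n \<Rightarrow> real ^ 'm \<Rightarrow> real ^ 'd)
      \<Rightarrow> real ^ 'n \<Rightarrow> (real ^ 'd) measure" where
  "pushforward \<Omega> \<nu> G \<theta> = distr \<nu> (restrict_space borel \<Omega>) (G \<theta>)"

definition mean_embedding ::
    "(real ^ 'd) set \<Rightarrow> ('h::real_inner \<Rightarrow> real ^ 'd \<Rightarrow> real) \<Rightarrow> (real ^ 'd \<Rightarrow> 'h)
      \<Rightarrow> (real ^ 'd) measure \<Rightarrow> 'h" where
  "mean_embedding \<Omega> ev K \<rho> = (THE m. \<forall>x\<in>\<Omega>. ev m x = (\<integral>y. ev (K x) y \<partial>\<rho>))"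

definition gradient_of ::
    "(real ^ 'd) set \<Rightarrow> (real ^ 'd \<Rightarrow> real) \<Rightarrow> real ^ 'd \<Rightarrow> real ^ 'd" where
  "gradient_of \<Omega> f x = (\<chi> j. partial_deriv \<Omega> j f x)"

definition kernel_gradient ::
    "(real ^ 'd) set \<Rightarrow> (real ^ 'd \<Rightarrow> 'h::real_normed_vector) \<Rightarrow> real ^ 'd \<Rightarrow> 'h ^ 'd" where
  "kernel_gradient \<Omega> K x = (\<chi> j. partial_deriv \<Omega> j K x)"

definition jac ::
    "(real ^ 'n) set \<Rightarrow> (real ^ 'n \<Rightarrow> real ^ 'm \<Rightarrow> real ^ 'd) \<Rightarrow> real ^ 'n \<Rightarrow> real ^ 'm
      \<Rightarrow> real ^ 'd ^ 'n" where
  "jac \<Theta> G \<theta> z = (\<chi> i j. partial_deriv \<Theta> i (\<lambda>\<eta>. G \<eta> z $ j) \<theta>)"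

definition L_op ::
    "(real ^ 'd) set \<Rightarrow> ('h \<Rightarrow> real ^ 'd \<Rightarrow> real) \<Rightarrow> (real ^ 'm) measure \<Rightarrow> (real ^ 'n) set
      \<Rightarrow> (real ^ 'n \<Rightarrow> real ^ 'm \<Rightarrow> real ^ 'd) \<Rightarrow> real ^ 'n \<Rightarrow> 'h \<Rightarrow> real ^ 'n" where
  "L_op \<Omega> ev \<nu> \<Theta> G \<theta> f = (\<integral>z. jac \<Theta> G \<theta> z *v gradient_of \<Omega> (ev f) (G \<theta> z) \<partial>\<nu>)"

definition Lt_op ::
    "(real ^ 'd) set \<Rightarrow> (real ^ 'd \<Rightarrow> 'h::{real_inner, banach, second_countable_topology})
      \<Rightarrow> (real ^ 'm) measure \<Rightarrow> (real ^ 'n) set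
      \<Rightarrow> (real ^ 'n \<Rightarrow> real ^ 'm \<Rightarrow> real ^ 'd) \<Rightarrow> real ^ 'n \<Rightarrow> real ^ 'n \<Rightarrow> 'h" where
  "Lt_op \<Omega> K \<nu> \<Theta> G \<theta> v =
     (\<integral>z. (\<Sum>j\<in>UNIV. (transpose (jac \<Theta> G \<theta> z) *v v) $ j *\<^sub>R
                  kernel_gradient \<Omega> K (G \<theta> z) $ j) \<partial>\<nu>)"

definition D_op ::
    "(real ^ 'd) set \<Rightarrow> ('h::{real_inner, banach, second_countable_topology} \<Rightarrow> real ^ 'd \<Rightarrow> real)
      \<Rightarrow> (real ^ 'd \<Rightarrow> 'h) \<Rightarrow> (real ^ 'm) measure \<Rightarrow> (real ^ 'n) set
      \<Rightarrow> (real ^ 'n \<Rightarrow> real ^ 'm \<Rightarrow> real ^ 'd) \<Rightarrow> real ^ 'n \<Rightarrow> 'h \<Rightarrow> 'h" where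
  "D_op \<Omega> ev K \<nu> \<Theta> G \<theta> f = Lt_op \<Omega> K \<nu> \<Theta> G \<theta> (L_op \<Omega> ev \<nu> \<Theta> G \<theta> f)"

text \<open>
  The metric tensor at \<open>\<theta>\<close>, meaningful for arguments in the range of \<open>L_op\<close>. There the value does
  not depend on the chosen preimages, which is why it can be written with a definite description.
\<close>

definition metric_tensor ::
    "real \<Rightarrow> real \<Rightarrow> (real ^ 'd) set
      \<Rightarrow> ('h::{real_inner, banach, second_countable_topology} \<Rightarrow> real ^ 'd \<Rightarrow> real)
      \<Rightarrow> (real ^ 'd \<Rightarrow> 'h) \<Rightarrow> (real ^ 'm) measure \<Rightarrow> (real ^ 'n) set
      \<Rightarrow> (real ^ 'n \<Rightarrow> real ^ 'm \<Rightarrow> real ^ 'd) \<Rightarrow> real ^ 'n \<Rightarrow> real ^ 'n \<Rightarrow> real ^ 'n \<Rightarrow> real" where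
  "metric_tensor \<alpha> \<beta> \<Omega> ev K \<nu> \<Theta> G \<theta> \<xi>\<^sub>1 \<xi>\<^sub>2 =
     (THE c. \<forall>\<phi>\<^sub>1 \<phi>\<^sub>2. L_op \<Omega> ev \<nu> \<Theta> G \<theta> \<phi>\<^sub>1 = \<xi>\<^sub>1 \<longrightarrow> L_op \<Omega> ev \<nu> \<Theta> G \<theta> \<phi>\<^sub>2 = \<xi>\<^sub>2 \<longrightarrow>
        c = \<alpha> * inner (D_op \<Omega> ev K \<nu> \<Theta> G \<theta> \<phi>\<^sub>1) (D_op \<Omega> ev K \<nu> \<Theta> G \<theta> \<phi>\<^sub>2)
          + \<beta> * inner \<phi>\<^sub>1 (D_op \<Omega> ev K \<nu> \<Theta> G \<theta> \<phi>\<^sub>2))"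

text \<open>
  The defining property of the gradient at \<open>\<theta>\<close>. The test curves \<open>\<gamma>\<close> live on an arbitrary
  nondegenerate interval \<open>T\<close> containing \<open>0\<close>, so that curves starting at \<open>\<theta>\<close> at time \<open>0\<close> and
  curves passing through \<open>\<theta>\<close> are both covered.
\<close>

definition is_metric_gradient ::
    "real \<Rightarrow> real \<Rightarrow> (real ^ 'd) set
      \<Rightarrow> ('h::{real_inner, banach, second_countable_topology} \<Rightarrow> real ^ 'd \<Rightarrow> real)
      \<Rightarrow> (real ^ 'd \<Rightarrow> 'h) \<Rightarrow> (real ^ 'm) measure \<Rightarrow> (real ^ 'n) set
      \<Rightarrow> (real ^ 'n \<Rightarrow> real ^ 'm \<Rightarrow> real ^ 'd) \<Rightarrow> ((real ^ 'd) measure \<Rightarrow> real)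
      \<Rightarrow> real ^ 'n \<Rightarrow> real ^ 'n \<Rightarrow> bool" where
  "is_metric_gradient \<alpha> \<beta> \<Omega> ev K \<nu> \<Theta> G F \<theta> v \<longleftrightarrow>
     v \<in> range (L_op \<Omega> ev \<nu> \<Theta> G \<theta>) \<and>
     (\<forall>T \<gamma> \<xi>. is_interval T \<longrightarrow> 0 \<in> T \<longrightarrow> T \<noteq> {0} \<longrightarrow>
        (\<forall>t\<in>T. \<gamma> t \<in> \<Theta>) \<longrightarrow> \<gamma> differentiable_on T \<longrightarrow> \<gamma> 0 = \<theta> \<longrightarrow>
        (\<gamma> has_vector_derivative \<xi>) (at 0 within T) \<longrightarrow>
        \<xi> \<in> range (L_op \<Omega> ev \<nu> \<Theta> G \<theta>) \<longrightarrow>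
        ((\<lambda>t. F (pushforward \<Omega> \<nu> G (\<gamma> t))) has_real_derivative
            metric_tensor \<alpha> \<beta> \<Omega> ev K \<nu> \<Theta> G \<theta> v \<xi>) (at (0::real) within T))"

definition metric_gradient ::
    "real \<Rightarrow> real \<Rightarrow> (real ^ 'd) set
      \<Rightarrow> ('h::{real_inner, banach, second_countable_topology} \<Rightarrow> real ^ 'd \<Rightarrow> real)
      \<Rightarrow> (real ^ 'd \<Rightarrow> 'h) \<Rightarrow> (real ^ 'm) measure \<Rightarrow> (real ^ 'n) set
      \<Rightarrow> (real ^ 'n \<Rightarrow> real ^ 'm \<Rightarrow> real ^ 'd) \<Rightarrow> ((real ^ 'd) measure \<Rightarrow> real)
      \<Rightarrow> real ^ 'n \<Rightarrow> real ^ 'n" where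
  "metric_gradient \<alpha> \<beta> \<Omega> ev K \<nu> \<Theta> G F \<theta> =
     (THE v. is_metric_gradient \<alpha> \<beta> \<Omega> ev K \<nu> \<Theta> G F \<theta> v)"

text \<open>
  The chain rule property of \<open>H\<close>: the map \<open>\<theta> \<mapsto> H(\<mu>\<^bsub>q\<^sub>\<theta>\<^esub>)\<close> is differentiable on \<open>\<Theta>\<close> and its partial
  derivatives are those of \<open>\<theta> \<mapsto> \<mu>\<^bsub>q\<^sub>\<theta>\<^esub>\<close> paired with \<open>h \<theta>\<close>.
\<close>

definition chain_rule_property ::
    "(real ^ 'd) set \<Rightarrow> ('h::real_inner \<Rightarrow> real ^ 'd \<Rightarrow> real) \<Rightarrow> (real ^ 'd \<Rightarrow> 'h)
      \<Rightarrow> (real ^ 'm) measure \<Rightarrow> (real ^ 'n) set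
      \<Rightarrow> (real ^ 'n \<Rightarrow> real ^ 'm \<Rightarrow> real ^ 'd) \<Rightarrow> ('h \<Rightarrow> real) \<Rightarrow> (real ^ 'n \<Rightarrow> 'h) \<Rightarrow> bool" where
  "chain_rule_property \<Omega> ev K \<nu> \<Theta> G H h \<longleftrightarrow>
     (\<forall>\<theta>\<in>\<Theta>.
        (\<lambda>\<eta>. H (mean_embedding \<Omega> ev K (pushforward \<Omega> \<nu> G \<eta>))) differentiable (at \<theta> within \<Theta>) \<and>
        (\<forall>i. partial_deriv \<Theta> i (\<lambda>\<eta>. H (mean_embedding \<Omega> ev K (pushforward \<Omega> \<nu> G \<eta>))) \<theta> =
             inner (h \<theta>)
               (partial_deriv \<Theta> i (\<lambda>\<eta>. mean_embedding \<Omega> ev K (pushforward \<Omega> \<nu> G \<eta>)) \<theta>)))"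

end

theory Submission
  imports Defs
begin

text \<open>
  For fixed \<open>\<theta>\<close> everything is finite-dimensional. By the chain rule
  \<open>\<psi>\<^sub>i(z) = \<Sum>\<^sub>j \<partial>\<^sub>iG\<^sup>j(z) \<partial>\<^sub>jk(G\<^sub>\<theta>(z), \<cdot>)\<close> is the \<open>\<theta>\<^sub>i\<close>-derivative of \<open>k(G\<^sub>\<theta>(z), \<cdot>)\<close>. The
  difference quotients are dominated by \<open>L D(z)\<close>, so dominated convergence gives
  \<open>\<Psi>\<^sub>i := \<integral> \<psi>\<^sub>i d\<nu> = \<partial>\<^sub>i \<mu>\<close>, where \<open>\<mu>\<close> is the mean embedding. Hence \<open>L\<^sub>\<theta> f = (\<langle>f, \<Psi>\<^sub>i\<rangle>)\<^sub>i\<close>,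
  its adjoint is \<open>v \<mapsto> \<Sum>\<^sub>i v\<^sub>i \<Psi>\<^sub>i\<close>, and the chain rule property says that the derivative of \<open>F\<close>
  in direction \<open>\<xi> = L\<^sub>\<theta> \<phi>\<close> is \<open>\<langle>h, \<Sum>\<^sub>i \<xi>\<^sub>i \<Psi>\<^sub>i\<rangle> = \<langle>h, D\<^sub>\<theta> \<phi>\<rangle> = \<langle>(\<alpha> D\<^sub>\<theta> + \<beta> I) u, D\<^sub>\<theta> \<phi>\<rangle>\<close>, which is
  \<open>g(L\<^sub>\<theta> u, \<xi>)\<close>.
\<close>

section \<open>Linear algebra of a finite family of vectors in an inner product space\<close>

definition pairing :: "('n \<Rightarrow> 'h::real_inner) \<Rightarrow> 'h \<Rightarrow> real ^ 'n" where
  "pairing \<Psi> f = (\<chi> i. inner f (\<Psi> i))"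

definition lincomb :: "('n::finite \<Rightarrow> 'h::real_inner) \<Rightarrow> real ^ 'n \<Rightarrow> 'h" where
  "lincomb \<Psi> v = (\<Sum>i\<in>UNIV. v $ i *\<^sub>R \<Psi> i)"

lemma inner_lincomb: "inner f (lincomb \<Psi> v) = inner (pairing \<Psi> f) v"
  by (simp add: lincomb_def pairing_def inner_sum_right inner_vec_def mult.commute)

lemma linear_pairing: "linear (pairing \<Psi>)"
  by (intro linearI) (simp_all add: pairing_def vec_eq_iff inner_add_left)

lemma linear_lincomb: "linear (lincomb \<Psi>)"
  by (intro linearI)
    (simp_all add: lincomb_def scaleR_add_left sum.distrib scaleR_sum_right)

text \<open>Applying \<open>pairing \<Psi>\<close> to the equation turns it into
  \<open>M v = pairing \<Psi> h\<close> for \<open>v = pairing \<Psi> u\<close>. This is a linear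
  system on the finite-dimensional coefficient space with \<open>M\<close> positive definite, and
  \<open>u\<close> is recovered from \<open>v\<close>.\<close>

lemma regularized_lincomb_pairing_unique_solution:
  fixes \<Psi> :: "'n::finite \<Rightarrow> 'h::real_inner"
  assumes "\<alpha> > 0" "\<beta> > 0"
  shows "\<exists>!u. \<alpha> *\<^sub>R lincomb \<Psi> (pairing \<Psi> u) + \<beta> *\<^sub>R u = h"
proof -
  interpret P: linear "pairing \<Psi>" by (rule linear_pairing)
  interpret C: linear "lincomb \<Psi>" by (rule linear_lincomb)
  define M where "M v = \<alpha> *\<^sub>R pairing \<Psi> (lincomb \<Psi> v) + \<beta> *\<^sub>R v" for v
  have linM: "linear M"
    unfolding M_def by (intro linearI) (simp_all add: C.add P.add C.scale P.scale algebra_simps)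
  have "v = 0" if "M v = 0" for v
  proof -
    \<comment> \<open>Adjointness of \<open>pairing\<close> and \<open>lincomb\<close> makes the
      quadratic form of \<open>M\<close> a sum of two squares with positive weights.\<close>
    have "0 = inner (M v) v" using that by simp
    also have "\<dots> = \<alpha> * inner (lincomb \<Psi> v) (lincomb \<Psi> v) + \<beta> * inner v v"
      by (simp add: M_def inner_add_left inner_lincomb)
    finally have "\<beta> * inner v v \<le> 0" using assms(1)
      by (smt (verit) inner_ge_zero mult_nonneg_nonneg)
    then show "v = 0" using assms(2)
      by (smt (verit) inner_gt_zero_iff mult_pos_pos)
  qed
  then have "inj M" by (simp add: linear_injective_0[OF linM])
  then have "surj M" by (rule linear_inj_imp_surj[OF linM])
  then obtain w where w: "M w = pairing \<Psi> h" by (metis surjD)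
  \<comment> \<open>This is the equation solved for \<open>u\<close> after replacing the unknown
    \<open>pairing \<Psi> u\<close> by \<open>w\<close>. The choice is consistent once
    \<open>pairing \<Psi> u = w\<close> is checked.\<close>
  define u where "u = (1/\<beta>) *\<^sub>R (h - \<alpha> *\<^sub>R lincomb \<Psi> w)"
  have "pairing \<Psi> u = (1/\<beta>) *\<^sub>R (M w - \<alpha> *\<^sub>R pairing \<Psi> (lincomb \<Psi> w))"
    by (simp add: u_def w P.scale P.diff)
  also have "\<dots> = w" using assms(2) by (simp add: M_def)
  finally have "\<alpha> *\<^sub>R lincomb \<Psi> (pairing \<Psi> u) + \<beta> *\<^sub>R u = h"
    using assms(2) by (simp add: u_def)
  moreover have "u' = u''"
    if "\<alpha> *\<^sub>R lincomb \<Psi> (pairing \<Psi> u') + \<beta> *\<^sub>R u' = h"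
      "\<alpha> *\<^sub>R lincomb \<Psi> (pairing \<Psi> u'') + \<beta> *\<^sub>R u'' = h" for u' u''
  proof -
    \<comment> \<open>Two solutions have the same pairing because \<open>M\<close> is injective. The
      \<open>\<alpha>\<close> terms then coincide and cancel.\<close>
    have "M (pairing \<Psi> u') = pairing \<Psi> h" "M (pairing \<Psi> u'') = pairing \<Psi> h"
      unfolding M_def P.add[symmetric] P.scale[symmetric] that by (rule refl)+
    then have "pairing \<Psi> u' = pairing \<Psi> u''" using \<open>inj M\<close> by (metis injD)
    then have "\<beta> *\<^sub>R u' = \<beta> *\<^sub>R u''" using that by (metis add_left_cancel)
    then show ?thesis using assms(2) by simp
  qed
  ultimately show ?thesis by blast
qed

section \<open>Partial derivatives and difference quotients within a set\<close>

lemma partial_deriv_eqI: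
  assumes "((\<lambda>t. f (x + t *\<^sub>R axis i 1)) has_vector_derivative f')
             (at 0 within {t. x + t *\<^sub>R axis i 1 \<in> S})"
    and "0 islimpt {t. x + t *\<^sub>R axis i 1 \<in> S}"
  shows "partial_deriv S i f x = f'"
  \<comment> \<open>\<open>vector_derivative\<close> selects some derivative; the limit point
    condition makes the derivative at 0 within the slice unique.\<close>
  unfolding partial_deriv_def
  using assms vector_derivative_within trivial_limit_within by metis

lemma has_vector_derivative_along_axis:
  assumes "(f has_derivative f') (at x within S)"
  shows "((\<lambda>t. f (x + t *\<^sub>R axis i 1)) has_vector_derivative f' (axis i 1))
           (at 0 within {t. x + t *\<^sub>R axis i 1 \<in> S})"
proof -
  have "((\<lambda>t. x + t *\<^sub>R axis i 1) has_vector_derivative axis i 1)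
          (at 0 within {t. x + t *\<^sub>R axis i 1 \<in> S})"
    by (auto intro!: derivative_eq_intros)
  moreover have "(f has_derivative f')
      (at (x + 0 *\<^sub>R axis i 1) within (\<lambda>t. x + t *\<^sub>R axis i 1) ` {t. x + t *\<^sub>R axis i 1 \<in> S})"
    by (simp, rule has_derivative_subset[OF assms]) auto
  ultimately show ?thesis
    using vector_derivative_diff_chain_within by (fastforce simp: o_def)
qed

lemma partial_deriv_has_derivative:
  assumes "(f has_derivative f') (at x within S)"
    and "0 islimpt {t. x + t *\<^sub>R axis i 1 \<in> S}"
  shows "partial_deriv S i f x = f' (axis i 1)"
  by (rule partial_deriv_eqI[OF has_vector_derivative_along_axis[OF assms(1)] assms(2)])

lemma open_islimpt_axis:
  fixes x :: "real ^ 'k"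
  assumes "open S" "x \<in> S"
  shows "0 islimpt {t. x + t *\<^sub>R axis i 1 \<in> S}"
proof -
  have "open {t. x + t *\<^sub>R axis i 1 \<in> S}"
    using open_vimage[OF assms(1), of "\<lambda>t. x + t *\<^sub>R axis i 1"]
    by (simp add: vimage_def continuous_intros)
  then show ?thesis using assms(2) by (intro open_imp_islimpt) auto
qed

lemma linear_sum_axis:
  fixes f :: "real ^ 'k \<Rightarrow> 'b::real_vector"
  assumes "linear f"
  shows "f v = (\<Sum>j\<in>UNIV. v $ j *\<^sub>R f (axis j 1))"
proof -
  have "v = (\<Sum>j\<in>UNIV. v $ j *\<^sub>R axis j 1)"
    by (simp add: basis_expansion flip: scalar_mult_eq_scaleR)
  then have "f v = f (\<Sum>j\<in>UNIV. v $ j *\<^sub>R axis j 1)" by simp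
  then show ?thesis by (simp add: linear_sum[OF assms] linear_cmul[OF assms])
qed

text \<open>In this form derivatives can be tested along sequences, which is what dominated
  convergence requires.\<close>

lemma has_vector_derivative_at_0_iff_tendsto:
  "(f has_vector_derivative f') (at 0 within S)
     \<longleftrightarrow> ((\<lambda>t. (f t - f 0) /\<^sub>R t) \<longlongrightarrow> f') (at 0 within S)"
proof -
  have "(f has_vector_derivative f') (at 0 within S)
     \<longleftrightarrow> ((\<lambda>t. norm (f t - f 0 - t *\<^sub>R f') / norm t) \<longlongrightarrow> 0) (at 0 within S)"
    by (simp add: has_vector_derivative_def has_derivative_iff_norm bounded_linear_scaleR_left)
  also have "\<dots> \<longleftrightarrow> ((\<lambda>t. norm ((f t - f 0) /\<^sub>R t - f')) \<longlongrightarrow> 0) (at 0 within S)"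
  proof (intro tendsto_cong, unfold eventually_at_filter, intro always_eventually allI impI)
    fix t :: real assume "t \<noteq> 0"
    then have "(f t - f 0) /\<^sub>R t - f' = (f t - f 0 - t *\<^sub>R f') /\<^sub>R t"
      by (simp add: scaleR_diff_right)
    then show "norm (f t - f 0 - t *\<^sub>R f') / norm t = norm ((f t - f 0) /\<^sub>R t - f')"
      by (simp add: divide_inverse mult.commute)
  qed
  also have "\<dots> \<longleftrightarrow> ((\<lambda>t. (f t - f 0) /\<^sub>R t) \<longlongrightarrow> f') (at 0 within S)"
    by (simp only: tendsto_norm_zero_iff LIM_zero_iff)
  finally show ?thesis .
qed

section \<open>The mean embedding and its derivative in the parameter\<close>

context pushforward_model
begin

lemma space_nu: "space \<nu> = Z"
  using sets_eq_imp_space_eq[OF sets_nu] by (simp add: space_restrict_space)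

lemma G_in_Omega: "\<theta> \<in> \<Theta> \<Longrightarrow> z \<in> Z \<Longrightarrow> G \<theta> z \<in> \<Omega>"
  using measurable_space[OF G_measurable] by (auto simp: space_nu space_restrict_space)

lemma K_measurable: "K \<in> borel_measurable (restrict_space borel \<Omega>)"
  by (intro borel_measurable_continuous_on_restrict)
    (meson K_differentiable continuous_at_imp_continuous_on differentiable_imp_continuous_within)

lemma KG_measurable: "\<theta> \<in> \<Theta> \<Longrightarrow> (\<lambda>z. K (G \<theta> z)) \<in> borel_measurable \<nu>"
  using measurable_compose[OF G_measurable K_measurable] .

text \<open>The reproducing property gives \<open>norm (K x)\<close> squared = k(x,x), so a bounded
  kernel bounds the integrand uniformly, and \<open>\<nu>\<close> is a probability measure.\<close>

lemma KG_integrable: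
  assumes "\<theta> \<in> \<Theta>"
  shows "integrable \<nu> (\<lambda>z. K (G \<theta> z))"
proof -
  obtain B where B: "\<And>x y. x \<in> \<Omega> \<Longrightarrow> y \<in> \<Omega> \<Longrightarrow> \<bar>ev (K x) y\<bar> \<le> B"
    using bounded_kernel by blast
  have "norm (K x) \<le> sqrt B" if "x \<in> \<Omega>" for x
    using B[OF that that] reproducing[OF that]
    by (simp add: norm_eq_sqrt_inner)
  then show ?thesis
    using KG_measurable[OF assms] G_in_Omega[OF assms]
    by (intro integrable_const_bound[where B = "sqrt B"]) (auto simp: space_nu)
qed

text \<open>Pairing the Bochner integral with \<open>K x\<close> and changing variables yields the
  values prescribed for the embedding; \<open>ev_inject\<close> then settles the definite
  description.\<close>

lemma mean_embedding_pushforward: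
  assumes "\<theta> \<in> \<Theta>"
  shows "mean_embedding \<Omega> ev K (pushforward \<Omega> \<nu> G \<theta>) = (\<integral>z. K (G \<theta> z) \<partial>\<nu>)"
proof -
  have "(\<integral>y. ev (K x) y \<partial>pushforward \<Omega> \<nu> G \<theta>) = ev (\<integral>z. K (G \<theta> z) \<partial>\<nu>) x"
    if x: "x \<in> \<Omega>" for x
  proof -
    have "(\<integral>y. ev (K x) y \<partial>pushforward \<Omega> \<nu> G \<theta>) = (\<integral>y. inner (K x) (K y) \<partial>pushforward \<Omega> \<nu> G \<theta>)"
      by (intro Bochner_Integration.integral_cong)
        (auto simp: pushforward_def space_restrict_space reproducing)
    also have "\<dots> = (\<integral>z. inner (K x) (K (G \<theta> z)) \<partial>\<nu>)"
      unfolding pushforward_def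
      by (intro integral_distr G_measurable assms borel_measurable_inner K_measurable) simp
    also have "\<dots> = inner (K x) (\<integral>z. K (G \<theta> z) \<partial>\<nu>)"
      using KG_integrable[OF assms] by simp
    finally show ?thesis using reproducing[OF x] by (simp add: inner_commute)
  qed
  then show ?thesis
    unfolding mean_embedding_def
    by (intro the_equality ev_inject) auto
qed

text \<open>The psi_i of the overview, written through the partial derivatives occurring in
  \<open>L_op\<close> and \<open>Lt_op\<close>.\<close>

definition tangent :: "real ^ 'n \<Rightarrow> 'n \<Rightarrow> real ^ 'm \<Rightarrow> 'h" where
  "tangent \<theta> i z = (\<Sum>j\<in>UNIV. jac \<Theta> G \<theta> z $ i $ j *\<^sub>R kernel_gradient \<Omega> K (G \<theta> z) $ j)"

lemma tangent_has_vector_derivative: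
  assumes "\<theta> \<in> \<Theta>" "z \<in> Z"
  shows "((\<lambda>t. K (G (\<theta> + t *\<^sub>R axis i 1) z)) has_vector_derivative tangent \<theta> i z)
           (at 0 within {t. \<theta> + t *\<^sub>R axis i 1 \<in> \<Theta>})"
proof -
  note x = G_in_Omega[OF assms]
  obtain K' where K': "(K has_derivative K') (at (G \<theta> z))"
    using K_differentiable[OF x] by (auto simp: differentiable_def)
  obtain G' where G': "((\<lambda>\<eta>. G \<eta> z) has_derivative G') (at \<theta> within \<Theta>)"
    using G_differentiable[OF assms] by (auto simp: differentiable_def)
  have "jac \<Theta> G \<theta> z $ i $ j = G' (axis i 1) $ j" for j
  proof -
    have "((\<lambda>\<eta>. G \<eta> z $ j) has_derivative (\<lambda>v. G' v $ j)) (at \<theta> within \<Theta>)"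
      using bounded_linear.has_derivative[OF bounded_linear_vec_nth G'] .
    then show ?thesis
      using partial_deriv_has_derivative[OF _ Theta_directions[OF assms(1)]] by (simp add: jac_def)
  qed
  moreover have "kernel_gradient \<Omega> K (G \<theta> z) $ j = K' (axis j 1)" for j
    using partial_deriv_has_derivative[OF has_derivative_at_withinI[OF K']]
      open_islimpt_axis[OF open_Omega x] by (simp add: kernel_gradient_def)
  \<comment> \<open>The vector \<open>G' (axis i 1)\<close> is expanded in the standard basis: its
    coordinates are the Jacobian entries, and \<open>K'\<close> sends the basis vectors to the
    components of the kernel gradient.\<close>
  ultimately have eq: "tangent \<theta> i z = K' (G' (axis i 1))"
    by (subst linear_sum_axis[OF has_derivative_linear[OF K']]) (simp add: tangent_def)
  have "((\<lambda>\<eta>. K (G \<eta> z)) has_derivative (\<lambda>v. K' (G' v))) (at \<theta> within \<Theta>)"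
    using has_derivative_compose[OF G' K'] .
  from has_vector_derivative_along_axis[OF this] show ?thesis by (simp add: eq)
qed

text \<open>The dominating function is \<open>L * D z\<close>, so the first moment of
  \<open>D\<close> must be finite. The second moment controls it because constants are
  integrable.\<close>

lemma D_integrable: "integrable \<nu> D"
proof (rule Bochner_Integration.integrable_bound)
  show "integrable \<nu> (\<lambda>z. 1 + (D z)\<^sup>2)" using D_square_integrable by simp
  have "\<bar>D z\<bar> \<le> 1 + (D z)\<^sup>2" for z
  proof -
    have "0 \<le> (\<bar>D z\<bar> - 1)\<^sup>2" by simp
    then have "2 * \<bar>D z\<bar> \<le> 1 + (D z)\<^sup>2" by (simp add: power2_diff)
    then show ?thesis by linarith
  qed
  then show "AE z in \<nu>. norm (D z) \<le> norm (1 + (D z)\<^sup>2)" by (auto simp: add_nonneg_nonneg)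
qed (use D_square_integrable in auto)

lemma KG_difference_quotient_bound:
  assumes "\<theta> \<in> \<Theta>" "\<theta> + t *\<^sub>R axis i 1 \<in> \<Theta>" "z \<in> Z" "t \<noteq> 0"
  shows "norm ((K (G (\<theta> + t *\<^sub>R axis i 1) z) - K (G \<theta> z)) /\<^sub>R t) \<le> L * D z"
proof -
  have "norm (K (G (\<theta> + t *\<^sub>R axis i 1) z) - K (G \<theta> z))
          \<le> L * norm (G (\<theta> + t *\<^sub>R axis i 1) z - G \<theta> z)"
    using assms by (intro K_lipschitz G_in_Omega)
  also have "\<dots> \<le> L * (D z * norm (\<theta> + t *\<^sub>R axis i 1 - \<theta>))"
    using assms L_pos by (intro mult_left_mono G_lipschitz) auto
  also have "\<dots> = L * D z * \<bar>t\<bar>" by simp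
  finally show ?thesis using assms(4) by (simp add: divide_simps mult.commute)
qed

text \<open>Dominated convergence for the difference quotients, with majorant
  \<open>L * D z\<close>, gives both the integrability of the limit and the exchange of limit and
  integral.\<close>

lemma tangent_dominated:
  assumes "\<theta> \<in> \<Theta>" "\<And>k. s k \<noteq> 0" "\<And>k. \<theta> + s k *\<^sub>R axis i 1 \<in> \<Theta>" "s \<longlonglongrightarrow> 0"
  shows "integrable \<nu> (tangent \<theta> i)"
    and "(\<lambda>k. \<integral>z. (K (G (\<theta> + s k *\<^sub>R axis i 1) z) - K (G \<theta> z)) /\<^sub>R s k \<partial>\<nu>)
           \<longlonglongrightarrow> (\<integral>z. tangent \<theta> i z \<partial>\<nu>)"
proof -
  let ?q = "\<lambda>k z. (K (G (\<theta> + s k *\<^sub>R axis i 1) z) - K (G \<theta> z)) /\<^sub>R s k"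
  have meas: "?q k \<in> borel_measurable \<nu>" for k
    using assms by (intro borel_measurable_scaleR borel_measurable_diff KG_measurable) auto
  have lim: "(\<lambda>k. ?q k z) \<longlonglongrightarrow> tangent \<theta> i z" if "z \<in> Z" for z
  proof -
    have "((\<lambda>t. (K (G (\<theta> + t *\<^sub>R axis i 1) z) - K (G \<theta> z)) /\<^sub>R t) \<longlongrightarrow> tangent \<theta> i z)
            (at 0 within {t. \<theta> + t *\<^sub>R axis i 1 \<in> \<Theta>})"
      using tangent_has_vector_derivative[OF assms(1) that, of i]
      by (simp add: has_vector_derivative_at_0_iff_tendsto)
    then show ?thesis using assms(2-4)
      unfolding tendsto_at_iff_sequentially by (auto simp: o_def)
  qed
  \<comment> \<open>Measurability is inherited from the difference quotients, so the derivatives of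
    \<open>G\<close> and \<open>K\<close> need not be treated separately.\<close>
  have meas': "tangent \<theta> i \<in> borel_measurable \<nu>"
    by (rule borel_measurable_LIMSEQ_metric[where f = ?q, OF meas]) (simp add: lim space_nu)
  have dom: "AE z in \<nu>. norm (?q k z) \<le> L * D z" for k
    by (rule AE_I2, rule KG_difference_quotient_bound) (use assms in \<open>auto simp: space_nu\<close>)
  note hyps = meas' meas integrable_mult_right[OF D_integrable] AE_I2 dom
  show "integrable \<nu> (tangent \<theta> i)"
    by (rule integrable_dominated_convergence[where s = ?q, OF hyps]) (simp add: lim space_nu)
  show "(\<lambda>k. \<integral>z. ?q k z \<partial>\<nu>) \<longlonglongrightarrow> (\<integral>z. tangent \<theta> i z \<partial>\<nu>)"
    by (rule integral_dominated_convergence[where s = ?q, OF hyps]) (simp add: lim space_nu)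
qed

lemma tangent_integrable:
  assumes "\<theta> \<in> \<Theta>"
  shows "integrable \<nu> (tangent \<theta> i)"
proof -
  \<comment> \<open>\<open>Theta_directions\<close> supplies nonzero admissible step sizes tending
    to 0.\<close>
  obtain s where "\<And>k. s k \<in> {t. \<theta> + t *\<^sub>R axis i 1 \<in> \<Theta>} - {0}" "s \<longlonglongrightarrow> 0"
    using Theta_directions[OF assms] unfolding islimpt_sequential by blast
  then show ?thesis using tangent_dominated(1)[OF assms, of s i] by simp
qed

definition mean_tangent :: "real ^ 'n \<Rightarrow> 'n \<Rightarrow> 'h" where
  "mean_tangent \<theta> i = (\<integral>z. tangent \<theta> i z \<partial>\<nu>)"

text \<open>Differentiation under the integral sign: by linearity the quotients of the embedding are
  integrals of the pointwise quotients, whose limit is known along every admissible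
  sequence.\<close>

lemma partial_deriv_mean_embedding:
  assumes "\<theta> \<in> \<Theta>"
  shows "partial_deriv \<Theta> i (\<lambda>\<eta>. mean_embedding \<Omega> ev K (pushforward \<Omega> \<nu> G \<eta>)) \<theta>
           = mean_tangent \<theta> i"
proof (rule partial_deriv_eqI[OF _ Theta_directions[OF assms]])
  let ?\<mu> = "\<lambda>\<eta>. mean_embedding \<Omega> ev K (pushforward \<Omega> \<nu> G \<eta>)"
  let ?S = "{t. \<theta> + t *\<^sub>R axis i 1 \<in> \<Theta>}"
  have "(\<lambda>k. (?\<mu> (\<theta> + s k *\<^sub>R axis i 1) - ?\<mu> \<theta>) /\<^sub>R s k) \<longlonglongrightarrow> mean_tangent \<theta> i"
    if s: "\<forall>k. s k \<in> ?S - {0}" "s \<longlonglongrightarrow> 0" for s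
  proof -
    have "(?\<mu> (\<theta> + s k *\<^sub>R axis i 1) - ?\<mu> \<theta>) /\<^sub>R s k
        = (\<integral>z. (K (G (\<theta> + s k *\<^sub>R axis i 1) z) - K (G \<theta> z)) /\<^sub>R s k \<partial>\<nu>)" for k
      using s(1) assms by (simp add: mean_embedding_pushforward KG_integrable)
    then show ?thesis
      using tangent_dominated(2)[OF assms, of s i] s by (simp add: mean_tangent_def)
  qed
  then show "((\<lambda>t. ?\<mu> (\<theta> + t *\<^sub>R axis i 1)) has_vector_derivative mean_tangent \<theta> i) (at 0 within ?S)"
    unfolding has_vector_derivative_at_0_iff_tendsto tendsto_at_iff_sequentially by (simp add: o_def)
qed

section \<open>The operators and the metric tensor in terms of the mean tangents\<close>

lemma gradient_of_ev:
  assumes "x \<in> \<Omega>"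
  shows "gradient_of \<Omega> (ev f) x $ j = inner f (kernel_gradient \<Omega> K x $ j)"
proof -
  obtain K' where K': "(K has_derivative K') (at x)"
    using K_differentiable[OF assms] by (auto simp: differentiable_def)
  note lp = open_islimpt_axis[OF open_Omega assms]
  have "((\<lambda>y. inner f (K y)) has_derivative (\<lambda>v. inner f (K' v))) (at x within \<Omega>)"
    using has_derivative_at_withinI[OF K'] by (rule has_derivative_inner_right)
  \<comment> \<open>\<open>ev f\<close> is given by the inner product only on
    \<open>\<Omega>\<close>, so the derivative is transferred within
    \<open>\<Omega>\<close>.\<close>
  then have "(ev f has_derivative (\<lambda>v. inner f (K' v))) (at x within \<Omega>)"
    by (rule has_derivative_transform[OF assms, rotated]) (simp add: reproducing)
  then show ?thesis
    using partial_deriv_has_derivative[OF _ lp]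
      partial_deriv_has_derivative[OF has_derivative_at_withinI[OF K'] lp]
    by (simp add: gradient_of_def kernel_gradient_def)
qed

lemma L_op_eq_pairing:
  assumes "\<theta> \<in> \<Theta>"
  shows "L_op \<Omega> ev \<nu> \<Theta> G \<theta> f = pairing (mean_tangent \<theta>) f"
proof -
  \<comment> \<open>Writing the integrand as scalar functions times fixed axis vectors reduces the
    vector-valued integral to integrals of \<open>inner f (tangent \<theta> i z)\<close>.\<close>
  have vec: "v = (\<Sum>i\<in>UNIV. v $ i *\<^sub>R axis i 1)" for v :: "real ^ 'n"
    using linear_sum_axis[of "\<lambda>x. x" v] by (simp add: linear_id[unfolded id_def])
  have "(jac \<Theta> G \<theta> z *v gradient_of \<Omega> (ev f) (G \<theta> z)) $ i = inner f (tangent \<theta> i z)"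
    if "z \<in> Z" for z i
    using gradient_of_ev[OF G_in_Omega[OF assms that]]
    by (simp add: matrix_vector_mult_def tangent_def inner_sum_right)
  then have "jac \<Theta> G \<theta> z *v gradient_of \<Omega> (ev f) (G \<theta> z)
      = (\<Sum>i\<in>UNIV. inner f (tangent \<theta> i z) *\<^sub>R axis i 1)" if "z \<in> Z" for z
    using that by (subst vec) simp
  then have "L_op \<Omega> ev \<nu> \<Theta> G \<theta> f = (\<integral>z. (\<Sum>i\<in>UNIV. inner f (tangent \<theta> i z) *\<^sub>R axis i 1) \<partial>\<nu>)"
    unfolding L_op_def by (intro Bochner_Integration.integral_cong) (auto simp: space_nu)
  also have "\<dots> = (\<Sum>i\<in>UNIV. inner f (mean_tangent \<theta> i) *\<^sub>R axis i 1)"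
    using tangent_integrable[OF assms] by (simp add: mean_tangent_def)
  also have "\<dots> = pairing (mean_tangent \<theta>) f"
    by (subst (2) vec) (simp add: pairing_def)
  finally show ?thesis .
qed

lemma Lt_op_eq_lincomb:
  assumes "\<theta> \<in> \<Theta>"
  shows "Lt_op \<Omega> K \<nu> \<Theta> G \<theta> v = lincomb (mean_tangent \<theta>) v"
proof -
  have "(\<Sum>j\<in>UNIV. (transpose (jac \<Theta> G \<theta> z) *v v) $ j *\<^sub>R kernel_gradient \<Omega> K (G \<theta> z) $ j)
      = (\<Sum>i\<in>UNIV. v $ i *\<^sub>R tangent \<theta> i z)" for z
    unfolding tangent_def matrix_vector_mult_def transpose_def
    by (simp add: scaleR_sum_left scaleR_sum_right mult.commute) (rule sum.swap)
  then show ?thesis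
    using tangent_integrable[OF assms] by (simp add: Lt_op_def lincomb_def mean_tangent_def)
qed

lemma D_op_eq:
  "\<theta> \<in> \<Theta> \<Longrightarrow> D_op \<Omega> ev K \<nu> \<Theta> G \<theta> f
     = lincomb (mean_tangent \<theta>) (pairing (mean_tangent \<theta>) f)"
  by (simp add: D_op_def L_op_eq_pairing Lt_op_eq_lincomb)

text \<open>\<open>D_op\<close> at a preimage is \<open>lincomb\<close> of its image under
  \<open>L_op\<close>, and adjointness rewrites the \<open>\<beta>\<close> term likewise. Hence the
  value is independent of the preimages, and the range hypotheses provide preimages that pin it
  down.\<close>

lemma metric_tensor_eq:
  assumes "\<theta> \<in> \<Theta>" and "\<xi>\<^sub>1 \<in> range (L_op \<Omega> ev \<nu> \<Theta> G \<theta>)" "\<xi>\<^sub>2 \<in> range (L_op \<Omega> ev \<nu> \<Theta> G \<theta>)"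
  shows "metric_tensor \<alpha> \<beta> \<Omega> ev K \<nu> \<Theta> G \<theta> \<xi>\<^sub>1 \<xi>\<^sub>2
     = \<alpha> * inner (lincomb (mean_tangent \<theta>) \<xi>\<^sub>1) (lincomb (mean_tangent \<theta>) \<xi>\<^sub>2) + \<beta> * inner \<xi>\<^sub>1 \<xi>\<^sub>2"
proof -
  let ?c = "\<alpha> * inner (lincomb (mean_tangent \<theta>) \<xi>\<^sub>1) (lincomb (mean_tangent \<theta>) \<xi>\<^sub>2) + \<beta> * inner \<xi>\<^sub>1 \<xi>\<^sub>2"
  have c: "?c = \<alpha> * inner (D_op \<Omega> ev K \<nu> \<Theta> G \<theta> \<phi>\<^sub>1) (D_op \<Omega> ev K \<nu> \<Theta> G \<theta> \<phi>\<^sub>2)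
        + \<beta> * inner \<phi>\<^sub>1 (D_op \<Omega> ev K \<nu> \<Theta> G \<theta> \<phi>\<^sub>2)"
    if "L_op \<Omega> ev \<nu> \<Theta> G \<theta> \<phi>\<^sub>1 = \<xi>\<^sub>1" "L_op \<Omega> ev \<nu> \<Theta> G \<theta> \<phi>\<^sub>2 = \<xi>\<^sub>2" for \<phi>\<^sub>1 \<phi>\<^sub>2
    unfolding that[symmetric]
    by (simp add: D_op_eq[OF assms(1)] L_op_eq_pairing[OF assms(1)] inner_lincomb[of \<phi>\<^sub>1])
  obtain \<phi>\<^sub>1 \<phi>\<^sub>2 where "L_op \<Omega> ev \<nu> \<Theta> G \<theta> \<phi>\<^sub>1 = \<xi>\<^sub>1" "L_op \<Omega> ev \<nu> \<Theta> G \<theta> \<phi>\<^sub>2 = \<xi>\<^sub>2"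
    using assms(2,3) by blast
  note \<phi> = this
  show ?thesis
    unfolding metric_tensor_def
  proof (rule the_equality)
    fix x
    assume "\<forall>\<phi>\<^sub>1 \<phi>\<^sub>2. L_op \<Omega> ev \<nu> \<Theta> G \<theta> \<phi>\<^sub>1 = \<xi>\<^sub>1 \<longrightarrow> L_op \<Omega> ev \<nu> \<Theta> G \<theta> \<phi>\<^sub>2 = \<xi>\<^sub>2 \<longrightarrow>
      x = \<alpha> * inner (D_op \<Omega> ev K \<nu> \<Theta> G \<theta> \<phi>\<^sub>1) (D_op \<Omega> ev K \<nu> \<Theta> G \<theta> \<phi>\<^sub>2)
        + \<beta> * inner \<phi>\<^sub>1 (D_op \<Omega> ev K \<nu> \<Theta> G \<theta> \<phi>\<^sub>2)"
    from this[rule_format, OF \<phi>] c[OF \<phi>] show "x = ?c" by (rule trans[OF _ sym])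
  qed (intro allI impI c)
qed

section \<open>The derivative of the functional, and existence and uniqueness of the
  gradient\<close>

lemma chain_rule_has_derivative:
  assumes "chain_rule_property \<Omega> ev K \<nu> \<Theta> G H h" "\<theta> \<in> \<Theta>"
  shows "((\<lambda>\<eta>. H (mean_embedding \<Omega> ev K (pushforward \<Omega> \<nu> G \<eta>))) has_derivative
            (\<lambda>\<xi>. inner (h \<theta>) (lincomb (mean_tangent \<theta>) \<xi>))) (at \<theta> within \<Theta>)"
proof -
  let ?f = "\<lambda>\<eta>. H (mean_embedding \<Omega> ev K (pushforward \<Omega> \<nu> G \<eta>))"
  obtain f' where f': "(?f has_derivative f') (at \<theta> within \<Theta>)"
    using assms unfolding chain_rule_property_def differentiable_def by blast
  have "f' (axis i 1) = inner (h \<theta>) (mean_tangent \<theta> i)" for i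
    using assms unfolding chain_rule_property_def
    by (metis partial_deriv_has_derivative[OF f' Theta_directions] partial_deriv_mean_embedding)
  \<comment> \<open>A linear map is determined by its values on the axis vectors.\<close>
  then have "f' = (\<lambda>\<xi>. inner (h \<theta>) (lincomb (mean_tangent \<theta>) \<xi>))"
    by (intro ext, subst linear_sum_axis[OF has_derivative_linear[OF f']])
      (simp add: lincomb_def inner_sum_right)
  then show ?thesis using f' by simp
qed

lemma is_metric_gradient_L_op:
  assumes "chain_rule_property \<Omega> ev K \<nu> \<Theta> G H h" "\<theta> \<in> \<Theta>"
    and F_eq: "\<And>\<theta>. \<theta> \<in> \<Theta> \<Longrightarrow>
      F (pushforward \<Omega> \<nu> G \<theta>) = H (mean_embedding \<Omega> ev K (pushforward \<Omega> \<nu> G \<theta>))"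
    and u: "\<alpha> *\<^sub>R D_op \<Omega> ev K \<nu> \<Theta> G \<theta> u + \<beta> *\<^sub>R u = h \<theta>"
  shows "is_metric_gradient \<alpha> \<beta> \<Omega> ev K \<nu> \<Theta> G F \<theta> (L_op \<Omega> ev \<nu> \<Theta> G \<theta> u)"
  unfolding is_metric_gradient_def
proof (intro conjI allI impI)
  let ?C = "lincomb (mean_tangent \<theta>)"
  let ?g = "metric_tensor \<alpha> \<beta> \<Omega> ev K \<nu> \<Theta> G \<theta> (L_op \<Omega> ev \<nu> \<Theta> G \<theta> u)"
  fix T :: "real set" and \<gamma> \<xi>
  assume "0 \<in> T" and \<gamma>: "\<forall>t\<in>T. \<gamma> t \<in> \<Theta>" "\<gamma> 0 = \<theta>"
    and d\<gamma>: "(\<gamma> has_vector_derivative \<xi>) (at 0 within T)"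
    and \<xi>: "\<xi> \<in> range (L_op \<Omega> ev \<nu> \<Theta> G \<theta>)"
  \<comment> \<open>Adjointness moves the \<open>\<beta>\<close> term onto \<open>?C \<xi>\<close>
    as well, so both terms combine into the left side of the equation for \<open>u\<close>, paired
    with \<open>?C \<xi>\<close>.\<close>
  have "?g \<xi> = \<alpha> * inner (?C (pairing (mean_tangent \<theta>) u)) (?C \<xi>) + \<beta> * inner u (?C \<xi>)"
    by (subst metric_tensor_eq[OF assms(2) _ \<xi>])
      (simp_all add: L_op_eq_pairing[OF assms(2)] inner_lincomb[of u])
  also have "\<dots> = inner (h \<theta>) (?C \<xi>)"
    by (simp add: D_op_eq[OF assms(2)] inner_add_left flip: u)
  finally have g: "?g \<xi> = inner (h \<theta>) (?C \<xi>)" .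
  have "((\<lambda>\<eta>. H (mean_embedding \<Omega> ev K (pushforward \<Omega> \<nu> G \<eta>))) has_derivative
            (\<lambda>\<xi>. inner (h \<theta>) (?C \<xi>))) (at (\<gamma> 0) within \<gamma> ` T)"
    unfolding \<gamma>(2) using \<gamma>(1)
    by (intro has_derivative_subset[OF chain_rule_has_derivative[OF assms(1,2)]]) auto
  from vector_derivative_diff_chain_within[OF d\<gamma> this]
  have "((\<lambda>t. H (mean_embedding \<Omega> ev K (pushforward \<Omega> \<nu> G (\<gamma> t)))) has_real_derivative ?g \<xi>)
          (at 0 within T)"
    by (simp add: o_def g has_real_derivative_iff_has_vector_derivative)
  \<comment> \<open>\<open>F\<close> and \<open>H\<close> are related only at parameters in
    \<open>\<Theta>\<close>, so the replacement is made within \<open>T\<close>, where the curve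
    stays in \<open>\<Theta>\<close>.\<close>
  then show "((\<lambda>t. F (pushforward \<Omega> \<nu> G (\<gamma> t))) has_real_derivative ?g \<xi>) (at 0 within T)"
    by (rule has_field_derivative_transform_within[OF _ zero_less_one \<open>0 \<in> T\<close>])
      (use \<gamma> F_eq in auto)
qed auto

text \<open>The difference of two gradients lies in the range of \<open>L_op\<close>, so it is
  itself an admissible velocity. Testing both along a straight line with this velocity shows that
  the difference has metric norm zero, and \<open>\<beta> > 0\<close> makes the metric definite. At
  an interior point the line stays in \<open>\<Theta>\<close> for short times.\<close>

lemma metric_gradient_unique:
  assumes \<theta>: "\<theta> \<in> interior \<Theta>" and pos: "\<alpha> > 0" "\<beta> > 0"
    and v: "is_metric_gradient \<alpha> \<beta> \<Omega> ev K \<nu> \<Theta> G F \<theta> v"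
    and w: "is_metric_gradient \<alpha> \<beta> \<Omega> ev K \<nu> \<Theta> G F \<theta> w"
  shows "v = w"
proof -
  let ?C = "lincomb (mean_tangent \<theta>)"
  let ?R = "range (L_op \<Omega> ev \<nu> \<Theta> G \<theta>)"
  have \<theta>': "\<theta> \<in> \<Theta>" using \<theta> interior_subset by blast
  have range: "v \<in> ?R" "w \<in> ?R" using v w by (auto simp: is_metric_gradient_def)
  define \<xi> where "\<xi> = v - w"
  have "?R = range (pairing (mean_tangent \<theta>))" by (simp add: L_op_eq_pairing[OF \<theta>'])
  moreover have "subspace (range (pairing (mean_tangent \<theta>)))"
    by (intro linear_subspace_image linear_pairing subspace_UNIV)
  ultimately have \<xi>: "\<xi> \<in> ?R"
    unfolding \<xi>_def using range subspace_diff by metis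
  obtain e where e: "e > 0" "cball \<theta> e \<subseteq> \<Theta>"
    using \<theta> mem_interior_cball by blast
  \<comment> \<open>For \<open>\<bar>t\<bar> \<le> d\<close> the displacement has norm at most
    \<open>e\<close>. The summand 1 keeps the denominator positive when
    \<open>\<xi> = 0\<close>.\<close>
  define d where "d = e / (1 + norm \<xi>)"
  have d: "d > 0" using e(1) by (simp add: d_def add_pos_nonneg)
  define T where "T = {-d..d}"
  have T: "is_interval T" "0 \<in> T" "T \<noteq> {0}"
    using d by (auto simp: T_def is_interval_cc atLeastAtMost_singleton_iff)
  have "\<theta> + t *\<^sub>R \<xi> \<in> \<Theta>" if "t \<in> T" for t
  proof -
    have "\<bar>t\<bar> * norm \<xi> \<le> d * (1 + norm \<xi>)"
      using that d by (intro mult_mono) (auto simp: T_def)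
    also have "\<dots> = e"
      using norm_ge_zero[of \<xi>] by (simp add: d_def add_nonneg_eq_0_iff)
    finally show ?thesis using e(2) by (auto simp: subset_iff dist_norm)
  qed
  moreover have "((\<lambda>t. \<theta> + t *\<^sub>R \<xi>) has_vector_derivative \<xi>) (at 0 within T)"
    by (auto intro!: derivative_eq_intros)
  moreover have "(\<lambda>t. \<theta> + t *\<^sub>R \<xi>) differentiable_on T"
    by simp
  ultimately have der: "((\<lambda>t. F (pushforward \<Omega> \<nu> G (\<theta> + t *\<^sub>R \<xi>))) has_real_derivative
      metric_tensor \<alpha> \<beta> \<Omega> ev K \<nu> \<Theta> G \<theta> x \<xi>) (at 0 within T)"
    if "is_metric_gradient \<alpha> \<beta> \<Omega> ev K \<nu> \<Theta> G F \<theta> x" for x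
    using that T \<xi> unfolding is_metric_gradient_def by auto
  have "metric_tensor \<alpha> \<beta> \<Omega> ev K \<nu> \<Theta> G \<theta> v \<xi> = metric_tensor \<alpha> \<beta> \<Omega> ev K \<nu> \<Theta> G \<theta> w \<xi>"
    using der[OF v] der[OF w] d unfolding T_def has_real_derivative_iff_has_vector_derivative
    by (intro vector_derivative_unique_within_closed_interval[of "-d" d 0]) auto
  \<comment> \<open>Subtracting the two metric values leaves the metric evaluated at
    \<open>\<xi>\<close> in both arguments.\<close>
  then have "\<alpha> * inner (?C \<xi>) (?C \<xi>) + \<beta> * inner \<xi> \<xi> = 0"
    unfolding metric_tensor_eq[OF \<theta>' range(1) \<xi>] metric_tensor_eq[OF \<theta>' range(2) \<xi>]
    by (simp add: linear_diff[OF linear_lincomb] \<xi>_def inner_diff_left algebra_simps)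
  then have "\<xi> = 0" using pos
    by (smt (verit) inner_ge_zero inner_gt_zero_iff mult_nonneg_nonneg mult_pos_pos)
  then show ?thesis by (simp add: \<xi>_def)
qed

end

text \<open>Uniqueness is claimed at interior points: elsewhere, curves in \<open>\<Theta>\<close>
  may realise too few velocities in the range of \<open>L_op\<close> to determine the
  gradient.\<close>

theorem theorem12:
  fixes \<Omega> :: "(real ^ 'd) set"
    and ev :: "'h::{real_inner, banach, second_countable_topology} \<Rightarrow> real ^ 'd \<Rightarrow> real"
    and K :: "real ^ 'd \<Rightarrow> 'h"
    and \<nu> :: "(real ^ 'm) measure"
    and Z :: "(real ^ 'm) set"
    and \<Theta> :: "(real ^ 'n) set"
    and G :: "real ^ 'n \<Rightarrow> real ^ 'm \<Rightarrow> real ^ 'd"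
    and L :: real
    and D :: "real ^ 'm \<Rightarrow> real"
    and \<alpha> \<beta> :: real
    and F :: "(real ^ 'd) measure \<Rightarrow> real"
    and H :: "'h \<Rightarrow> real"
    and h :: "real ^ 'n \<Rightarrow> 'h"
  assumes model: "pushforward_model \<Omega> ev K \<nu> Z \<Theta> G L D"
    and pos: "\<alpha> > 0" "\<beta> > 0"
    and F_eq: "\<And>\<theta>. \<theta> \<in> \<Theta> \<Longrightarrow>
      F (pushforward \<Omega> \<nu> G \<theta>) = H (mean_embedding \<Omega> ev K (pushforward \<Omega> \<nu> G \<theta>))"
    and chain_rule: "chain_rule_property \<Omega> ev K \<nu> \<Theta> G H h"
  shows "\<forall>\<theta>\<in>\<Theta>.
    (\<exists>!u. \<alpha> *\<^sub>R D_op \<Omega> ev K \<nu> \<Theta> G \<theta> u + \<beta> *\<^sub>R u = h \<theta>) \<and>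
    (\<forall>u. \<alpha> *\<^sub>R D_op \<Omega> ev K \<nu> \<Theta> G \<theta> u + \<beta> *\<^sub>R u = h \<theta> \<longrightarrow>
       is_metric_gradient \<alpha> \<beta> \<Omega> ev K \<nu> \<Theta> G F \<theta> (L_op \<Omega> ev \<nu> \<Theta> G \<theta> u) \<and>
       (\<theta> \<in> interior \<Theta> \<longrightarrow>
          (\<exists>!v. is_metric_gradient \<alpha> \<beta> \<Omega> ev K \<nu> \<Theta> G F \<theta> v) \<and>
          metric_gradient \<alpha> \<beta> \<Omega> ev K \<nu> \<Theta> G F \<theta> = L_op \<Omega> ev \<nu> \<Theta> G \<theta> u))"
proof (intro ballI conjI allI impI)
  interpret pushforward_model \<Omega> ev K \<nu> Z \<Theta> G L D by (rule model)
  fix \<theta> assume \<theta>: "\<theta> \<in> \<Theta>"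
  show "\<exists>!u. \<alpha> *\<^sub>R D_op \<Omega> ev K \<nu> \<Theta> G \<theta> u + \<beta> *\<^sub>R u = h \<theta>"
    unfolding D_op_eq[OF \<theta>] by (rule regularized_lincomb_pairing_unique_solution[OF pos])
  fix u assume u: "\<alpha> *\<^sub>R D_op \<Omega> ev K \<nu> \<Theta> G \<theta> u + \<beta> *\<^sub>R u = h \<theta>"
  show grad: "is_metric_gradient \<alpha> \<beta> \<Omega> ev K \<nu> \<Theta> G F \<theta> (L_op \<Omega> ev \<nu> \<Theta> G \<theta> u)"
    using chain_rule \<theta> F_eq u by (rule is_metric_gradient_L_op)
  assume int: "\<theta> \<in> interior \<Theta>"
  note unique = metric_gradient_unique[OF int pos]
  show "\<exists>!v. is_metric_gradient \<alpha> \<beta> \<Omega> ev K \<nu> \<Theta> G F \<theta> v"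
    using grad unique[OF _ grad] by (rule ex1I)
  show "metric_gradient \<alpha> \<beta> \<Omega> ev K \<nu> \<Theta> G F \<theta> = L_op \<Omega> ev \<nu> \<Theta> G \<theta> u"
    unfolding metric_gradient_def using grad unique[OF _ grad] by (rule the_equality)
qed

end
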